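(* The statistic $\tau$ has $S$-structure on $\mathcal{D}=\bigcup_{n\in\mathbb{N}}\mathcal{D}_n$. That is, for all $n,m\in\mathbb{N}$, all $a_{[1:n]},b_{[1:n]}\in\mathcal{D}_n$ and all $x_{[1:m]},y_{[1:m]}\in\mathcal{D}_m$ such that $a_{[1:n]}\sim_\tau b_{[1:n]}$, $x_{[1:m]}\sim_\tau y_{[1:m]}$ and such that the concatenations $a_{[1:n]}x_{[1:m]}$ and $b_{[1:n]}y_{[1:m]}$ belong to $\mathcal{D}_{n+m}$, it holds that $a_{[1:n]}x_{[1:m]}\sim_\tau b_{[1:n]}y_{[1:m]}$.
   Context: $\mathbb{N}_0=\{0,1,2,\dots\}$; $\delta_{ab}=1$ if $a=b$ and $0$ otherwise; $a_{[1:n]}=(a_1,\dots,a_n)$. For $n\ge1$ let $\mathcal{D}_n=\{a_{[1:n]}\in\mathbb{N}_0^n: a_i-a_{i+1}\le 1\text{ for all }1\le i\le n-1\}$ (down-skip-free strings). The statistic $\tau=(\tau_n)_{n\in\mathbb{N}}$ is defined on $\mathcal{D}_n$ by $$\tau_n(a_{[1:n]})=\Big(a_1,\ \sum_{k=1}^n\delta_{a_k0},\ I(a_{[1:n]})\Big),\qquad I(a_{[1:n]})=(\iota_r(a_{[1:n]}))_{r\in\mathbb{N}_0},$$ $$\iota_r(a_{[1:n]})=\#\{j\in\{1,\dots,n-1\}: a_{j+1}-a_j+(1-\delta_{a_j0})=r\}.$$ Write $a_{[1:n]}\sim_\tau b_{[1:n]}$ iff $\tau_n(a_{[1:n]})=\tau_n(b_{[1:n]})$.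 *)

theory Defs
  imports Main
begin

text \<open>
  A string \<open>a\<^sub>1 \<dots> a\<^sub>n\<close> over an alphabet is a list of length \<open>n\<close>, with \<open>a\<^sub>i\<close> being \<open>a ! (i - 1)\<close>;
  concatenation of strings is \<open>@\<close>.  A statistic is a family \<open>T\<close> indexed by the length \<open>n\<close>, and a
  class of strings is a family \<open>D\<close> with \<open>D n\<close> consisting of strings of length \<open>n\<close>; only \<open>n \<ge> 1\<close>
  is meaningful.  All differences of entries are taken in the integers.
\<close>

definition down_skip_free :: "nat \<Rightarrow> nat list set" where
  "down_skip_free n =
    {a. length a = n \<and> (\<forall>i. Suc i < n \<longrightarrow> int (a ! i) - int (a ! Suc i) \<le> 1)}"

definition iota :: "nat \<Rightarrow> nat list \<Rightarrow> nat \<Rightarrow> nat" where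
  "iota n a r =
    card {j. Suc j < n \<and> int (a ! Suc j) - int (a ! j) + (1 - of_bool (a ! j = 0)) = int r}"

definition tau :: "nat \<Rightarrow> nat list \<Rightarrow> nat \<times> nat \<times> (nat \<Rightarrow> nat)" where
  "tau n a = (a ! 0, \<Sum>k<n. of_bool (a ! k = 0), iota n a)"

definition stat_equiv :: "(nat \<Rightarrow> 'a list \<Rightarrow> 'b) \<Rightarrow> nat \<Rightarrow> 'a list \<Rightarrow> 'a list \<Rightarrow> bool" where
  "stat_equiv T n a b \<longleftrightarrow> T n a = T n b"

definition has_S_structure :: "(nat \<Rightarrow> 'a list set) \<Rightarrow> (nat \<Rightarrow> 'a list \<Rightarrow> 'b) \<Rightarrow> bool" where
  "has_S_structure D T \<longleftrightarrow>
    (\<forall>n\<ge>1. \<forall>m\<ge>1. \<forall>a\<in>D n. \<forall>b\<in>D n. \<forall>x\<in>D m. \<forall>y\<in>D m.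
      stat_equiv T n a b \<longrightarrow> stat_equiv T m x y \<longrightarrow>
      a @ x \<in> D (n + m) \<longrightarrow> b @ y \<in> D (n + m) \<longrightarrow>
      stat_equiv T (n + m) (a @ x) (b @ y))"

end

theory Submission
  imports Defs
begin

text \<open>
  The first letter of a concatenation \<open>ax\<close> is that of \<open>a\<close>, and the number of zeros is additive.
  So are the numbers \<open>\<iota>\<^sub>r\<close>, except that \<open>ax\<close> contains one further pair of neighbours: the last letter \<open>z\<close> of
  \<open>a\<close> and the first letter of \<open>x\<close>.  Its increment is \<open>x\<^sub>1 + 1 - max 1 z\<close>, so it suffices that \<open>\<tau>\<close>
  determines \<open>max 1 z\<close>; the letter \<open>z\<close> itself is not determined, since \<open>z = 0\<close> and \<open>z = 1\<close> can
  give the same value of \<open>\<tau>\<close>: the strings \<open>101\<close> and \<open>110\<close> are an example.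

  To recover \<open>max 1 z\<close>, add up all increments: the sum telescopes to an expression in \<open>max 1 z\<close>,
  the length, the first letter and the number of zeros (\<open>sum_increments\<close>).  On a down-skip-free
  string every increment is a natural number, hence each one is counted by some \<open>\<iota>\<^sub>r\<close> and the
  sum equals \<open>\<Sum>\<^sub>r r \<iota>\<^sub>r\<close>, which \<open>\<tau>\<close> determines (\<open>sum_eq_if_fibre_cards_eq\<close>).
\<close>

definition increment :: "nat list \<Rightarrow> nat \<Rightarrow> int" where
  "increment a j = int (a ! Suc j) + 1 - int (max 1 (a ! j))"

lemma iota_eq_card_increment:
  "iota n a r = card {j. Suc j < n \<and> increment a j = int r}"
proof -
  have "int (a ! Suc j) - int (a ! j) + (1 - of_bool (a ! j = 0)) = increment a j" for j
    by (simp add: increment_def max_def)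
  then show ?thesis
    by (simp add: iota_def)
qed

lemma increment_nonneg:
  assumes "a \<in> down_skip_free n" "Suc j < n"
  shows "0 \<le> increment a j"
  using assms by (force simp: down_skip_free_def increment_def)

text \<open>Consecutive letters cancel; \<open>max 1 v\<close> exceeds \<open>v\<close> exactly at the zeros of the string.\<close>

lemma sum_increments:
  "(\<Sum>j<n. increment a j) + (\<Sum>k<Suc n. of_bool (a ! k = 0)) + int (a ! 0) =
    int (max 1 (a ! n)) + int n"
  by (induction n) (auto simp: increment_def max_def)

text \<open>A finite sum of natural numbers depends only on how often each value occurs.\<close>

lemma sum_eq_if_fibre_cards_eq:
  fixes f g :: "'a \<Rightarrow> nat"
  assumes "finite A" "\<And>r. card {j \<in> A. f j = r} = card {j \<in> A. g j = r}"
  shows "sum f A = sum g A"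
proof -
  have group: "sum h A = (\<Sum>r\<in>h ` A. r * card {j \<in> A. h j = r})" for h :: "'a \<Rightarrow> nat"
    using sum.image_gen[OF assms(1), of h h] by (simp add: mult.commute)
  have "h ` A = {r. card {j \<in> A. h j = r} \<noteq> 0}" for h :: "'a \<Rightarrow> nat"
    using assms(1) by auto
  then have "f ` A = g ` A"
    by (simp add: assms(2))
  then show ?thesis
    by (simp add: group[of f] group[of g] assms(2))
qed

lemma sum_increments_eq_if_iota_eq:
  assumes "a \<in> down_skip_free (Suc n)" "b \<in> down_skip_free (Suc n)"
    and "iota (Suc n) a = iota (Suc n) b"
  shows "(\<Sum>j<n. increment a j) = (\<Sum>j<n. increment b j)"
proof -
  have iota_nat: "iota (Suc n) c r = card {j \<in> {..<n}. nat (increment c j) = r}"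
    and sum_nat: "(\<Sum>j<n. increment c j) = int (\<Sum>j<n. nat (increment c j))"
    if "c \<in> down_skip_free (Suc n)" for c r
  proof -
    have "0 \<le> increment c j" if "j < n" for j
      using increment_nonneg[OF \<open>c \<in> down_skip_free (Suc n)\<close>] that by simp
    then show "iota (Suc n) c r = card {j \<in> {..<n}. nat (increment c j) = r}"
      and "(\<Sum>j<n. increment c j) = int (\<Sum>j<n. nat (increment c j))"
      by (auto simp: iota_eq_card_increment intro!: arg_cong[where f = card])
  qed
  have "(\<Sum>j<n. nat (increment a j)) = (\<Sum>j<n. nat (increment b j))"
    by (rule sum_eq_if_fibre_cards_eq)
      (simp_all only: finite_lessThan flip: iota_nat[OF assms(1)] iota_nat[OF assms(2)] assms(3))
  then show ?thesis
    using assms(1,2) by (simp add: sum_nat)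
qed

lemma max_1_last_eq_if_tau_eq:
  assumes "a \<in> down_skip_free (Suc n)" "b \<in> down_skip_free (Suc n)"
    and "tau (Suc n) a = tau (Suc n) b"
  shows "max 1 (a ! n) = max 1 (b ! n)"
proof -
  have "a ! 0 = b ! 0" "iota (Suc n) a = iota (Suc n) b"
    and zeros: "(\<Sum>k<Suc n. of_bool (a ! k = 0) :: nat) = (\<Sum>k<Suc n. of_bool (b ! k = 0))"
    using assms(3) by (simp_all add: tau_def)
  moreover have "(\<Sum>k<Suc n. of_bool (a ! k = 0) :: int) = (\<Sum>k<Suc n. of_bool (b ! k = 0))"
    using arg_cong[OF zeros, of int] by simp
  ultimately have "int (max 1 (a ! n)) = int (max 1 (b ! n))"
    using sum_increments[of a n] sum_increments[of b n]
      sum_increments_eq_if_iota_eq[OF assms(1,2)] by linarith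
  then show ?thesis
    by simp
qed

text \<open>
  The pairs of neighbours in \<open>ax\<close> are those inside \<open>a\<close>, those inside \<open>x\<close>, and the pair at the
  junction.
\<close>

lemma iota_append:
  assumes "length a = Suc n" "length x = Suc m"
  shows "iota (Suc n + Suc m) (a @ x) r = iota (Suc n) a r + iota (Suc m) x r +
    of_bool (int (x ! 0) + 1 - int (max 1 (a ! n)) = int r)"
proof -
  let ?I = "\<lambda>c k. {j. Suc j < k \<and> increment c j = int r}"
  let ?J = "{j. j = n \<and> int (x ! 0) + 1 - int (max 1 (a ! n)) = int r}"
  let ?X = "(\<lambda>j. Suc n + j) ` ?I x (Suc m)"
  have left: "increment (a @ x) j = increment a j" if "j < n" for j
    using that assms by (simp add: increment_def nth_append)
  have junction: "increment (a @ x) n = int (x ! 0) + 1 - int (max 1 (a ! n))"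
    using assms by (simp add: increment_def nth_append)
  have right: "increment (a @ x) (Suc n + j) = increment x j" for j
    using assms by (simp add: increment_def nth_append)
  have "?I (a @ x) (Suc n + Suc m) = ?I a (Suc n) \<union> ?X \<union> ?J"
  proof (intro set_eqI)
    fix j
    consider "j < n" | "j = n" | i where "j = Suc n + i"
      by (metis less_imp_Suc_add add_Suc linorder_neqE_nat)
    then show "j \<in> ?I (a @ x) (Suc n + Suc m) \<longleftrightarrow> j \<in> ?I a (Suc n) \<union> ?X \<union> ?J"
    proof cases
      case 1
      then show ?thesis using left by auto
    next
      case 2
      then show ?thesis using junction by auto
    next
      case 3
      then show ?thesis using right[of i] by auto
    qed
  qed
  moreover have "card (?I a (Suc n) \<union> ?X \<union> ?J) = card (?I a (Suc n)) + card ?X + card ?J"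
    by (subst card_Un_disjoint; (subst card_Un_disjoint)?) auto
  moreover have "card ?X = card (?I x (Suc m))"
    by (intro card_image) (simp add: inj_on_def)
  moreover have "card ?J = of_bool (int (x ! 0) + 1 - int (max 1 (a ! n)) = int r)"
    by simp
  ultimately show ?thesis
    by (simp add: iota_eq_card_increment)
qed

lemma zeros_append:
  assumes "length a = n"
  shows "(\<Sum>k<n + m. of_bool ((a @ x) ! k = 0) :: nat) =
    (\<Sum>k<n. of_bool (a ! k = 0)) + (\<Sum>k<m. of_bool (x ! k = 0))"
  using assms by (induction m) (simp_all add: nth_append)

theorem proposition3p3: "has_S_structure down_skip_free tau"
  unfolding has_S_structure_def stat_equiv_def
proof (intro allI impI ballI)
  fix n m :: nat and a b x y
  assume "1 \<le> n" "1 \<le> m"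
    and D: "a \<in> down_skip_free n" "b \<in> down_skip_free n"
      "x \<in> down_skip_free m" "y \<in> down_skip_free m"
    and tau_ab: "tau n a = tau n b" and tau_xy: "tau m x = tau m y"
  then obtain n' m' where [simp]: "n = Suc n'" "m = Suc m'"
    by (metis One_nat_def Suc_le_D)
  have len: "length a = n" "length b = n" "length x = m" "length y = m"
    using D by (simp_all add: down_skip_free_def)
  have parts: "a ! 0 = b ! 0" "iota n a = iota n b" "x ! 0 = y ! 0" "iota m x = iota m y"
    "(\<Sum>k<n. of_bool (a ! k = 0) :: nat) = (\<Sum>k<n. of_bool (b ! k = 0))"
    "(\<Sum>k<m. of_bool (x ! k = 0) :: nat) = (\<Sum>k<m. of_bool (y ! k = 0))"
    using tau_ab tau_xy by (simp_all only: tau_def prod.inject)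
  have "max 1 (a ! n') = max 1 (b ! n')"
    using D(1,2) tau_ab by (intro max_1_last_eq_if_tau_eq) simp_all
  then have "iota (n + m) (a @ x) r = iota (n + m) (b @ y) r" for r
    using iota_append[of a n' x m' r] iota_append[of b n' y m' r] len parts by simp
  moreover have "(a @ x) ! 0 = (b @ y) ! 0"
    using len parts by (simp add: nth_append)
  moreover have "(\<Sum>k<n + m. of_bool ((a @ x) ! k = 0) :: nat) =
      (\<Sum>k<n + m. of_bool ((b @ y) ! k = 0))"
    by (simp only: zeros_append[OF len(1)] zeros_append[OF len(2)] parts)
  ultimately show "tau (n + m) (a @ x) = tau (n + m) (b @ y)"
    unfolding tau_def prod.inject by (intro conjI ext)
qed

end
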